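(* Let $\mathcal X$ be an infinite dimensional linear space over the field $\mathbb K$ of real or complex numbers. Then there exist uncountably many non-equivalent norms on $\mathcal X$; that is, there is an uncountable set of norms on $\mathcal X$ any two distinct members of which are non-equivalent.
   Context: Two norms $f,g$ on $\mathcal X$ are equivalent if there exist $\lambda,\mu>0$ with $\lambda f(x)\le g(x)\le\mu f(x)$ for all $x\in\mathcal X$. *)

theory Defs
  imports Complex_Main "HOL-Library.Countable_Set"
begin

(* The scalar type is instantiated to real or complex; norm c is then the absolute value
   (modulus) of the scalar c. *)
definition is_norm ::
  "('k::real_normed_field \<Rightarrow> 'a::ab_group_add \<Rightarrow> 'a) \<Rightarrow> ('a \<Rightarrow> real) \<Rightarrow> bool" where
  "is_norm scale f \<longleftrightarrow>
     (\<forall>x. 0 \<le> f x) \<and>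
     (\<forall>x. f x = 0 \<longleftrightarrow> x = 0) \<and>
     (\<forall>c x. f (scale c x) = norm c * f x) \<and>
     (\<forall>x y. f (x + y) \<le> f x + f y)"

definition equivalent_norms :: "('a \<Rightarrow> real) \<Rightarrow> ('a \<Rightarrow> real) \<Rightarrow> bool" where
  "equivalent_norms f g \<longleftrightarrow>
     (\<exists>l>0. \<exists>m>0. \<forall>x. l * f x \<le> g x \<and> g x \<le> m * f x)"

definition infinite_dimensional ::
  "('k::field \<Rightarrow> 'a::ab_group_add \<Rightarrow> 'a) \<Rightarrow> bool" where
  "infinite_dimensional scale \<longleftrightarrow>
     vector_space scale \<and> (\<nexists>B. finite_dimensional_vector_space scale B)"

end

theory Submission
  imports Defs "HOL-Analysis.Continuum_Not_Denumerable"
begin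

text \<open>
  Once a Hamel basis \<open>B\<close> is chosen, every positive weight function \<open>w\<close> on \<open>B\<close> gives a weighted
  \<open>\<ell>\<^sup>1\<close>-norm, in which a basis vector \<open>b\<close> has norm \<open>w b\<close>. If two such norms are equivalent, then
  evaluating them at the basis vectors shows that the quotient of their weights is bounded on \<open>B\<close>.
  As \<open>B\<close> is infinite, it contains a sequence of distinct vectors, and the weights \<open>(n + 1) powr t\<close>
  on its \<open>n\<close>-th term, extended by \<open>1\<close> to the rest of \<open>B\<close>, have pairwise unbounded quotients for
  different real exponents \<open>t\<close>. The reals being uncountable, so is this family of norms.
\<close>

definition weighted_l1_norm ::
  "('k::real_normed_field \<Rightarrow> 'a::ab_group_add \<Rightarrow> 'a) \<Rightarrow> 'a set \<Rightarrow> ('a \<Rightarrow> real) \<Rightarrow> 'a \<Rightarrow> real" where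
  "weighted_l1_norm scale B w x =
     (\<Sum>b | module.representation scale B x b \<noteq> 0. w b * norm (module.representation scale B x b))"

lemma is_norm_weighted_l1_norm:
  fixes scale :: "'k::real_normed_field \<Rightarrow> 'a::ab_group_add \<Rightarrow> 'a"
  assumes "vector_space scale"
    and indep: "\<not> module.dependent scale B" and span: "module.span scale B = UNIV"
    and pos: "\<And>b. 0 < w b"
  shows "is_norm scale (weighted_l1_norm scale B w)"
proof -
  interpret vector_space scale by fact
  let ?r = "representation B"
  let ?f = "weighted_l1_norm scale B w"
  \<comment> \<open>Norms of different vectors become comparable when both are sums over one common finite set.\<close>
  have on_superset: "?f x = (\<Sum>b\<in>A. w b * norm (?r x b))"
    if "finite A" "{b. ?r x b \<noteq> 0} \<subseteq> A" for x A
    unfolding weighted_l1_norm_def using that by (intro sum.mono_neutral_left) auto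
  have nonneg: "0 \<le> w b * norm (?r x b)" for x b
    using pos[of b] by simp
  have "0 \<le> ?f x" for x
    unfolding weighted_l1_norm_def by (intro sum_nonneg nonneg)
  moreover have "?f x = 0 \<longleftrightarrow> x = 0" for x
  proof
    assume "?f x = 0"
    then have "\<forall>b\<in>{b. ?r x b \<noteq> 0}. w b * norm (?r x b) = 0"
      unfolding weighted_l1_norm_def
      by (subst (asm) sum_nonneg_eq_0_iff) (auto simp: nonneg finite_representation)
    then have "?r x b = 0" for b
      using pos[of b] by force
    then show "x = 0"
      using sum_nonzero_representation_eq[OF indep, of x] span by simp
  next
    assume "x = 0"
    then show "?f x = 0"
      by (simp add: weighted_l1_norm_def representation_zero)
  qed
  moreover have "?f (scale c x) = norm c * ?f x" for c x
  proof -
    have "?r (scale c x) b = c * ?r x b" for b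
      using representation_scale[OF indep, of x c] span by simp
    then show ?thesis
      by (subst (1 2) on_superset[where A = "{b. ?r x b \<noteq> 0}"])
        (auto simp: finite_representation norm_mult sum_distrib_left mult_ac)
  qed
  moreover have "?f (x + y) \<le> ?f x + ?f y" for x y
  proof -
    let ?A = "{b. ?r x b \<noteq> 0} \<union> {b. ?r y b \<noteq> 0}"
    have add: "?r (x + y) b = ?r x b + ?r y b" for b
      using representation_add[OF indep, of y x] span by (simp add: add.commute)
    have fin: "finite ?A" by (simp add: finite_representation)
    have "?f (x + y) = (\<Sum>b\<in>?A. w b * norm (?r x b + ?r y b))"
      unfolding add[symmetric] by (rule on_superset[OF fin]) (auto simp: add)
    also have "\<dots> \<le> (\<Sum>b\<in>?A. w b * norm (?r x b) + w b * norm (?r y b))"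
      using pos by (intro sum_mono) (metis distrib_left less_imp_le mult_left_mono norm_triangle_ineq)
    also have "\<dots> = ?f x + ?f y"
      using on_superset[OF fin, of x] on_superset[OF fin, of y] by (simp add: sum.distrib)
    finally show ?thesis .
  qed
  ultimately show ?thesis
    by (simp add: is_norm_def)
qed

lemma weighted_l1_norm_basis:
  fixes scale :: "'k::real_normed_field \<Rightarrow> 'a::ab_group_add \<Rightarrow> 'a"
  assumes "vector_space scale" and indep: "\<not> module.dependent scale B" and "b \<in> B"
  shows "weighted_l1_norm scale B w b = w b"
proof -
  interpret vector_space scale by fact
  have "representation B b = (\<lambda>v. if v = b then 1 else 0)"
    using indep \<open>b \<in> B\<close> by (rule representation_basis)
  then show ?thesis
    by (simp add: weighted_l1_norm_def)
qed

lemma infinite_basis_exists: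
  fixes scale :: "'k::field \<Rightarrow> 'a::ab_group_add \<Rightarrow> 'a"
  assumes "infinite_dimensional scale"
  obtains B where "\<not> module.dependent scale B" "module.span scale B = UNIV" "infinite B"
proof -
  interpret vector_space scale
    using assms by (simp add: infinite_dimensional_def)
  obtain B where B: "independent B" "span B = UNIV"
    using independent_extend_basis[OF independent_empty] span_extend_basis[OF independent_empty]
    by blast
  have "infinite B"
  proof
    assume "finite B"
    then have "finite_dimensional_vector_space scale B"
      using B by unfold_locales
    then show False
      using assms by (auto simp: infinite_dimensional_def)
  qed
  with B that show ?thesis by blast
qed

lemma equivalent_norms_refl: "equivalent_norms f f"
  unfolding equivalent_norms_def by (intro exI[of _ 1] conjI) auto

lemma equivalent_norms_sym:
  assumes "equivalent_norms f g"
  shows "equivalent_norms g f"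
proof -
  obtain l m where lm: "l > 0" "m > 0" "\<And>x. l * f x \<le> g x" "\<And>x. g x \<le> m * f x"
    using assms by (auto simp: equivalent_norms_def)
  then have "inverse m * g x \<le> f x \<and> f x \<le> inverse l * g x" for x
    using lm(3,4)[of x] by (simp add: field_simps)
  then show ?thesis
    unfolding equivalent_norms_def using lm(1,2) by (meson inverse_positive_iff_positive)
qed

text \<open>The quotient of the two powers is \<open>(n + 1) powr (t - s)\<close>, which tends to infinity.\<close>

lemma powr_not_dominated:
  fixes s t :: real
  assumes "s < t"
  shows "\<exists>n::nat. m * (real n + 1) powr s < (real n + 1) powr t"
proof -
  \<comment> \<open>This \<open>n\<close> makes \<open>n + 1\<close> exceed the solution \<open>y\<close> of \<open>y powr (t - s) = max m 1\<close>.\<close>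
  obtain n where n: "max m 1 powr (1 / (t - s)) < real n"
    using reals_Archimedean2 by blast
  have "m \<le> (max m 1 powr (1 / (t - s))) powr (t - s)"
    using assms by (simp add: powr_powr)
  also have "\<dots> < (real n + 1) powr (t - s)"
    using assms n by (intro powr_less_mono2) auto
  finally have "m * (real n + 1) powr s < (real n + 1) powr (t - s) * (real n + 1) powr s"
    by simp
  then show ?thesis
    by (auto simp flip: powr_add)
qed

theorem uncountably_many_nonequivalent_norms:
  fixes scale :: "'k::real_normed_field \<Rightarrow> 'a::ab_group_add \<Rightarrow> 'a"
  assumes inf: "infinite_dimensional scale"
  shows "\<exists>N :: ('a \<Rightarrow> real) set. uncountable N \<and> (\<forall>f\<in>N. is_norm scale f) \<and>
           (\<forall>f\<in>N. \<forall>g\<in>N. f \<noteq> g \<longrightarrow> \<not> equivalent_norms f g)"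
proof -
  have vs: "vector_space scale"
    using inf by (simp add: infinite_dimensional_def)
  obtain B where B: "\<not> module.dependent scale B" "module.span scale B = UNIV" "infinite B"
    using infinite_basis_exists[OF inf] .
  obtain e :: "nat \<Rightarrow> 'a" where e: "inj e" "range e \<subseteq> B"
    using infinite_countable_subset[OF B(3)] by blast
  define w where "w t b = (if b \<in> range e then (real (inv e b) + 1) powr t else 1)" for t :: real and b
  define F where "F t = weighted_l1_norm scale B (w t)" for t
  have norm_F: "is_norm scale (F t)" for t
    unfolding F_def by (rule is_norm_weighted_l1_norm[OF vs B(1,2)]) (simp add: w_def)
  have F_e: "F t (e n) = (real n + 1) powr t" for t n
    using weighted_l1_norm_basis[OF vs B(1), of "e n" "w t"] e by (auto simp: F_def w_def)
  have less: "\<not> equivalent_norms (F s) (F t)" if "s < t" for s t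
  proof
    assume "equivalent_norms (F s) (F t)"
    then obtain m where "\<And>x. F t x \<le> m * F s x"
      by (auto simp: equivalent_norms_def)
    then have "(real n + 1) powr t \<le> m * (real n + 1) powr s" for n
      using F_e by metis
    then show False
      using powr_not_dominated[OF that, of m] by (meson not_le)
  qed
  have noneq: "\<not> equivalent_norms (F s) (F t)" if "s \<noteq> t" for s t
    using less[of s t] less[of t s] equivalent_norms_sym[of "F s" "F t"] that by linarith
  then have "inj F"
    by (metis equivalent_norms_refl injI)
  then have "uncountable (range F)"
    using countable_image_inj_on uncountable_UNIV_real by blast
  with norm_F noneq show ?thesis
    by (intro exI[of _ "range F"]) (metis imageE)
qed

theorem theorem4p10:
  "(\<forall>scale :: real \<Rightarrow> 'a::ab_group_add \<Rightarrow> 'a.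
      infinite_dimensional scale \<longrightarrow>
      (\<exists>N :: ('a \<Rightarrow> real) set. uncountable N \<and> (\<forall>f\<in>N. is_norm scale f) \<and>
         (\<forall>f\<in>N. \<forall>g\<in>N. f \<noteq> g \<longrightarrow> \<not> equivalent_norms f g))) \<and>
   (\<forall>scale :: complex \<Rightarrow> 'a \<Rightarrow> 'a.
      infinite_dimensional scale \<longrightarrow>
      (\<exists>N :: ('a \<Rightarrow> real) set. uncountable N \<and> (\<forall>f\<in>N. is_norm scale f) \<and>
         (\<forall>f\<in>N. \<forall>g\<in>N. f \<noteq> g \<longrightarrow> \<not> equivalent_norms f g)))"
  by (intro conjI allI impI uncountably_many_nonequivalent_norms)

end
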